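(* Let $(\mathcal{T},\Gamma)$ be a commutative $\Gamma$-semigroup and let $\mathcal{Q}$ be a $\Gamma$-2-sided ideal of $(\mathcal{T},\Gamma)$. Then $\mathcal{Q}$ is $\Gamma$-prime if and only if for all $e,f\in\mathcal{T}$, $e\Gamma f\subseteq\mathcal{Q}$ implies $e\in\mathcal{Q}$ or $f\in\mathcal{Q}$.
   Context: A $\Gamma$-semigroup $(\mathcal{T},\Gamma)$ consists of non-empty sets $\mathcal{T},\Gamma$ and a map $\mathcal{T}\times\Gamma\times\mathcal{T}\to\mathcal{T}$, $(e,\alpha,f)\mapsto e\alpha f$, with $(e\alpha f)\beta g=e\alpha(f\beta g)$ for all $e,f,g\in\mathcal{T}$, $\alpha,\beta\in\Gamma$. It is commutative if $e\alpha f=f\alpha e$ for all $e,f\in\mathcal{T}$, $\alpha\in\Gamma$. For $A,B\subseteq\mathcal{T}$ put $[A\Gamma B]=\{a\gamma b: a\in A,\gamma\in\Gamma,b\in B\}$, and $e\Gamma f=\{e\gamma f:\gamma\in\Gamma\}$. A subset $B\subseteq\mathcal{T}$ is a $\Gamma$-2-sided ideal if $[\mathcal{T}\Gamma B]\subseteq B$ and $[B\Gamma\mathcal{T}]\subseteq B$. A $\Gamma$-2-sided ideal $\mathcal{Q}$ is $\Gamma$-prime if for all $\Gamma$-2-sided ideals $\mathcal{E},\mathcal{F}$ of $\mathcal{T}$, $[\mathcal{E}\Gamma\mathcal{F}]\subseteq\mathcal{Q}$ implies $\mathcal{E}\subseteq\mathcal{Q}$ or $\mathcal{F}\subseteq\mathcal{Q}$.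 *)

theory Defs
  imports Main
begin

locale gamma_semigroup =
  fixes T :: "'a set" and G :: "'g set" and mul :: "'a \<Rightarrow> 'g \<Rightarrow> 'a \<Rightarrow> 'a"
  assumes carrier_nonempty: "T \<noteq> {}"
    and gamma_nonempty: "G \<noteq> {}"
    and mul_closed: "\<lbrakk>e \<in> T; \<alpha> \<in> G; f \<in> T\<rbrakk> \<Longrightarrow> mul e \<alpha> f \<in> T"
    and mul_assoc: "\<lbrakk>e \<in> T; f \<in> T; g \<in> T; \<alpha> \<in> G; \<beta> \<in> G\<rbrakk>
          \<Longrightarrow> mul (mul e \<alpha> f) \<beta> g = mul e \<alpha> (mul f \<beta> g)"

locale comm_gamma_semigroup = gamma_semigroup +
  assumes mul_commute: "\<lbrakk>e \<in> T; f \<in> T; \<alpha> \<in> G\<rbrakk> \<Longrightarrow> mul e \<alpha> f = mul f \<alpha> e"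

definition gamma_set_prod ::
    "'g set \<Rightarrow> ('a \<Rightarrow> 'g \<Rightarrow> 'a \<Rightarrow> 'a) \<Rightarrow> 'a set \<Rightarrow> 'a set \<Rightarrow> 'a set" where
  "gamma_set_prod G mul A B = {mul a \<gamma> b | a \<gamma> b. a \<in> A \<and> \<gamma> \<in> G \<and> b \<in> B}"

definition gamma_prod ::
    "'g set \<Rightarrow> ('a \<Rightarrow> 'g \<Rightarrow> 'a \<Rightarrow> 'a) \<Rightarrow> 'a \<Rightarrow> 'a \<Rightarrow> 'a set" where
  "gamma_prod G mul e f = {mul e \<gamma> f | \<gamma>. \<gamma> \<in> G}"

text \<open>The empty set counts as an ideal.\<close>

definition gamma_ideal ::
    "'a set \<Rightarrow> 'g set \<Rightarrow> ('a \<Rightarrow> 'g \<Rightarrow> 'a \<Rightarrow> 'a) \<Rightarrow> 'a set \<Rightarrow> bool" where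
  "gamma_ideal T G mul B \<longleftrightarrow>
     B \<subseteq> T \<and> gamma_set_prod G mul T B \<subseteq> B \<and> gamma_set_prod G mul B T \<subseteq> B"

text \<open>A prime ideal need not be proper.\<close>

definition gamma_prime ::
    "'a set \<Rightarrow> 'g set \<Rightarrow> ('a \<Rightarrow> 'g \<Rightarrow> 'a \<Rightarrow> 'a) \<Rightarrow> 'a set \<Rightarrow> bool" where
  "gamma_prime T G mul Q \<longleftrightarrow>
     gamma_ideal T G mul Q \<and>
     (\<forall>E F. gamma_ideal T G mul E \<longrightarrow> gamma_ideal T G mul F \<longrightarrow>
        gamma_set_prod G mul E F \<subseteq> Q \<longrightarrow> E \<subseteq> Q \<or> F \<subseteq> Q)"

end

(* For the nontrivial direction, no principal ideals are needed: if e \<Gamma> f \<subseteq> Q, let F = (Q : {e}) and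
   E = (Q : F) be colon ideals. Then f \<in> F, e \<in> E and E \<Gamma> F \<subseteq> Q, so primality puts e or f into Q. *)

theory Submission imports Defs begin

lemma gamma_idealD:
  assumes "gamma_ideal T G mul Q" "x \<in> Q" "t \<in> T" "\<gamma> \<in> G"
  shows "mul x \<gamma> t \<in> Q" "mul t \<gamma> x \<in> Q"
  using assms unfolding gamma_ideal_def gamma_set_prod_def by blast+

text \<open>The factor from \<open>S\<close> is written on the left, so that multiplying
  \<open>x\<close> on the right by an element of \<open>T\<close> only calls for rebracketing. For
  \<open>S = {}\<close> the colon is all of \<open>T\<close>.\<close>

definition gamma_colon ::
    "'a set \<Rightarrow> 'g set \<Rightarrow> ('a \<Rightarrow> 'g \<Rightarrow> 'a \<Rightarrow> 'a) \<Rightarrow> 'a set \<Rightarrow> 'a set \<Rightarrow> 'a set" where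
  "gamma_colon T G mul Q S = {x \<in> T. \<forall>s\<in>S. gamma_prod G mul s x \<subseteq> Q}"

text \<open>Right absorption is associativity: s \<gamma> (x \<beta> t) = (s \<gamma> x) \<beta> t,
  and \<open>Q\<close> absorbs t. Left absorption then follows by commutativity. Allowing any subset
  \<open>S\<close> of \<open>T\<close> lets the lemma serve both for a singleton and for a colon
  ideal.\<close>

lemma (in comm_gamma_semigroup) gamma_ideal_colon:
  assumes Q: "gamma_ideal T G mul Q" and S: "S \<subseteq> T"
  shows "gamma_ideal T G mul (gamma_colon T G mul Q S)"
proof -
  let ?C = "gamma_colon T G mul Q S"
  have right: "mul x \<beta> t \<in> ?C" if "x \<in> ?C" "t \<in> T" "\<beta> \<in> G" for x \<beta> t
  proof -
    have x: "x \<in> T" and xQ: "\<And>s \<gamma>. s \<in> S \<Longrightarrow> \<gamma> \<in> G \<Longrightarrow> mul s \<gamma> x \<in> Q"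
      using that(1) unfolding gamma_colon_def gamma_prod_def by blast+
    have "mul s \<gamma> (mul x \<beta> t) \<in> Q" if s: "s \<in> S" "\<gamma> \<in> G" for s \<gamma>
    proof -
      have "mul (mul s \<gamma> x) \<beta> t = mul s \<gamma> (mul x \<beta> t)"
        using s S x \<open>t \<in> T\<close> \<open>\<beta> \<in> G\<close> by (intro mul_assoc) auto
      then show ?thesis
        using gamma_idealD(1)[OF Q xQ[OF s] \<open>t \<in> T\<close> \<open>\<beta> \<in> G\<close>] by simp
    qed
    then show ?thesis
      using mul_closed[OF x \<open>\<beta> \<in> G\<close> \<open>t \<in> T\<close>] unfolding gamma_colon_def gamma_prod_def by blast
  qed
  have sub: "?C \<subseteq> T"
    unfolding gamma_colon_def by blast
  have left: "mul t \<beta> x \<in> ?C" if "x \<in> ?C" "t \<in> T" "\<beta> \<in> G" for x \<beta> t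
    using right[OF that] mul_commute[of t x \<beta>] that sub by auto
  show ?thesis
    using sub left right unfolding gamma_ideal_def gamma_set_prod_def by blast
qed

theorem theorem6p2:
  fixes T :: "'a set" and G :: "'g set" and mul :: "'a \<Rightarrow> 'g \<Rightarrow> 'a \<Rightarrow> 'a" and Q :: "'a set"
  assumes "comm_gamma_semigroup T G mul"
    and "gamma_ideal T G mul Q"
  shows "gamma_prime T G mul Q \<longleftrightarrow>
    (\<forall>e\<in>T. \<forall>f\<in>T. gamma_prod G mul e f \<subseteq> Q \<longrightarrow> e \<in> Q \<or> f \<in> Q)"
proof
  interpret comm_gamma_semigroup T G mul by fact
  assume prime: "gamma_prime T G mul Q"
  show "\<forall>e\<in>T. \<forall>f\<in>T. gamma_prod G mul e f \<subseteq> Q \<longrightarrow> e \<in> Q \<or> f \<in> Q"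
  proof (intro ballI impI)
    fix e f assume e: "e \<in> T" and f: "f \<in> T" and ef: "gamma_prod G mul e f \<subseteq> Q"
    define F where "F = gamma_colon T G mul Q {e}"
    \<comment> \<open>Taking the colon by all of \<open>F\<close> forces the product of
      \<open>E\<close> and \<open>F\<close> into \<open>Q\<close>, up to the order of the
      factors.\<close>
    define E where "E = gamma_colon T G mul Q F"
    have FT: "F \<subseteq> T" and ET: "E \<subseteq> T"
      unfolding E_def F_def gamma_colon_def by blast+
    have F: "gamma_ideal T G mul F"
      unfolding F_def using e by (intro gamma_ideal_colon assms(2)) simp
    have E: "gamma_ideal T G mul E"
      unfolding E_def using FT by (intro gamma_ideal_colon assms(2))
    have "f \<in> F"
      using f ef unfolding F_def gamma_colon_def by blast
    \<comment> \<open>Membership of \<open>e\<close> in \<open>E\<close> asks for products with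
      \<open>e\<close> on the right, while \<open>F\<close> controls those with \<open>e\<close> on
      the left; commutativity swaps them.\<close>
    have "mul x \<gamma> e \<in> Q" if "x \<in> F" "\<gamma> \<in> G" for x \<gamma>
    proof -
      have "mul e \<gamma> x \<in> Q"
        using that unfolding F_def gamma_colon_def gamma_prod_def by blast
      then show ?thesis
        using mul_commute[of x e \<gamma>] that FT e by auto
    qed
    then have "e \<in> E"
      using e unfolding E_def gamma_colon_def gamma_prod_def by blast
    \<comment> \<open>The same swap: the colon \<open>E\<close> has the factor from \<open>F\<close>
      on the left, whereas primality needs it on the right.\<close>
    have "mul y \<gamma> x \<in> Q" if "y \<in> E" "x \<in> F" "\<gamma> \<in> G" for x y \<gamma>
    proof -
      have "mul x \<gamma> y \<in> Q"
        using that unfolding E_def gamma_colon_def gamma_prod_def by blast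
      then show ?thesis
        using mul_commute[OF subsetD[OF ET] subsetD[OF FT]] that by simp
    qed
    then have "gamma_set_prod G mul E F \<subseteq> Q"
      unfolding gamma_set_prod_def by blast
    then have "E \<subseteq> Q \<or> F \<subseteq> Q"
      using prime E F unfolding gamma_prime_def by blast
    then show "e \<in> Q \<or> f \<in> Q"
      using \<open>e \<in> E\<close> \<open>f \<in> F\<close> by blast
  qed
next
  assume elementwise: "\<forall>e\<in>T. \<forall>f\<in>T. gamma_prod G mul e f \<subseteq> Q \<longrightarrow> e \<in> Q \<or> f \<in> Q"
  have "E \<subseteq> Q \<or> F \<subseteq> Q"
    if E: "gamma_ideal T G mul E" and F: "gamma_ideal T G mul F"
      and EF: "gamma_set_prod G mul E F \<subseteq> Q" for E F
  proof (rule ccontr)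
    assume "\<not> (E \<subseteq> Q \<or> F \<subseteq> Q)"
    \<comment> \<open>If both inclusions fail, each ideal has an element outside \<open>Q\<close>.
      All products of these two lie in the set product of \<open>E\<close> and \<open>F\<close>,
      hence in \<open>Q\<close>, against the elementwise condition.\<close>
    then obtain e f where e: "e \<in> E" "e \<notin> Q" and f: "f \<in> F" "f \<notin> Q"
      by blast
    have "e \<in> T" "f \<in> T"
      using e f E F unfolding gamma_ideal_def by blast+
    moreover have "gamma_prod G mul e f \<subseteq> Q"
      using e f EF unfolding gamma_prod_def gamma_set_prod_def by blast
    ultimately show False
      using elementwise e f by blast
  qed
  then show "gamma_prime T G mul Q"
    using assms(2) unfolding gamma_prime_def by blast
qed

end
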